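(* Let $A=(a_{ij})_{1\le i,j\le n}$ be an ASSR matrix with signature $\varepsilon=(\varepsilon_1,\dots,\varepsilon_n)$ and let $C(A)=(c_{ij})$ be its combined matrix. If $A$ is type-I staircase, then $C(A)$ is also type-I staircase.
   Context: The combined matrix of a nonsingular real matrix $A$ is $C(A)=A\circ (A^{-1})^T$ (Hadamard product). For $\alpha,\beta\in Q_{m,n}$ (increasing sequences of $m$ integers in $\{1,\dots,n\}$), $A[\alpha|\beta]$ is the submatrix with rows $\alpha$ and columns $\beta$. A real matrix $A=(a_{ij})$ is type-I staircase if: (i) $a_{ii}\neq 0$ for all $i$; (ii) if $a_{ij}=0$ with $i>j$, then $a_{kl}=0$ for all $l\le j$, $k\ge i$; (iii) if $a_{ij}=0$ with $i<j$, then $a_{kl}=0$ for all $k\le i$, $l\ge j$. It is type-II staircase if: (i) $a_{i,n-i+1}\neq 0$ for all $i$; (ii) if $a_{ij}=0$ with $j>n-i+1$, then $a_{kl}=0$ for all $k\ge i$, $l\ge j$; (iii) if $a_{ij}=0$ with $j<n-i+1$, then $a_{kl}=0$ for all $k\le i$, $l\le j$. For a type-I (resp. type-II) staircase matrix, $A[\alpha|\beta]$ is nontrivial if $a_{\alpha_i\beta_i}\neq0$ (resp. $a_{\alpha_i\beta_{m-i+1}}\neq 0$) for all $i$. $A$ is ASSR with signature $\varepsilon\in\{\pm1\}^n$ if it is type-I or type-II staircase and $\varepsilon_m\det A[\alpha|\beta]>0$ for every nontrivial submatrix of order $m$ (ASSR matrices are nonsingular). *)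

theory Defs
  imports
    Complex_Main
    "Jordan_Normal_Form.Determinant"
    "Jordan_Normal_Form.Gauss_Jordan_Elimination"
    "Jordan_Normal_Form.DL_Submatrix"
begin

text \<open>
  Rows and columns are numbered from 0, so the antidiagonal position \<open>(i, n - i + 1)\<close> of the
  usual 1-based numbering becomes \<open>(i, n - 1 - i)\<close>. Orders of minors, and hence the index
  of the signature, keep their usual values \<open>1, \<dots>, n\<close>.
\<close>

definition hadamard_prod :: "real mat \<Rightarrow> real mat \<Rightarrow> real mat" where
  "hadamard_prod A B = mat (dim_row A) (dim_col A) (\<lambda>(i, j). A $$ (i, j) * B $$ (i, j))"

text \<open>Meaningful for nonsingular \<open>A\<close> only; otherwise \<open>mat_inverse A\<close> is \<open>None\<close>.\<close>

definition combined_matrix :: "real mat \<Rightarrow> real mat" where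
  "combined_matrix A = hadamard_prod A (transpose_mat (the (mat_inverse A)))"

definition Q :: "nat \<Rightarrow> nat \<Rightarrow> nat list set" where
  "Q m n = {\<alpha>. length \<alpha> = m \<and> sorted_wrt (<) \<alpha> \<and> set \<alpha> \<subseteq> {..<n}}"

definition submat :: "real mat \<Rightarrow> nat list \<Rightarrow> nat list \<Rightarrow> real mat" where
  "submat A \<alpha> \<beta> = submatrix A (set \<alpha>) (set \<beta>)"

definition type_I_staircase :: "nat \<Rightarrow> real mat \<Rightarrow> bool" where
  "type_I_staircase n A \<longleftrightarrow>
     A \<in> carrier_mat n n \<and>
     (\<forall>i<n. A $$ (i, i) \<noteq> 0) \<and>
     (\<forall>i<n. \<forall>j<n. i > j \<and> A $$ (i, j) = 0 \<longrightarrow>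
        (\<forall>k<n. \<forall>l<n. l \<le> j \<and> k \<ge> i \<longrightarrow> A $$ (k, l) = 0)) \<and>
     (\<forall>i<n. \<forall>j<n. i < j \<and> A $$ (i, j) = 0 \<longrightarrow>
        (\<forall>k<n. \<forall>l<n. k \<le> i \<and> l \<ge> j \<longrightarrow> A $$ (k, l) = 0))"

definition type_II_staircase :: "nat \<Rightarrow> real mat \<Rightarrow> bool" where
  "type_II_staircase n A \<longleftrightarrow>
     A \<in> carrier_mat n n \<and>
     (\<forall>i<n. A $$ (i, n - 1 - i) \<noteq> 0) \<and>
     (\<forall>i<n. \<forall>j<n. j > n - 1 - i \<and> A $$ (i, j) = 0 \<longrightarrow>
        (\<forall>k<n. \<forall>l<n. k \<ge> i \<and> l \<ge> j \<longrightarrow> A $$ (k, l) = 0)) \<and>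
     (\<forall>i<n. \<forall>j<n. j < n - 1 - i \<and> A $$ (i, j) = 0 \<longrightarrow>
        (\<forall>k<n. \<forall>l<n. k \<le> i \<and> l \<le> j \<longrightarrow> A $$ (k, l) = 0))"

definition nontrivial_I :: "real mat \<Rightarrow> nat list \<Rightarrow> nat list \<Rightarrow> bool" where
  "nontrivial_I A \<alpha> \<beta> \<longleftrightarrow> (\<forall>i<length \<alpha>. A $$ (\<alpha> ! i, \<beta> ! i) \<noteq> 0)"

definition nontrivial_II :: "real mat \<Rightarrow> nat list \<Rightarrow> nat list \<Rightarrow> bool" where
  "nontrivial_II A \<alpha> \<beta> \<longleftrightarrow>
     (\<forall>i<length \<alpha>. A $$ (\<alpha> ! i, \<beta> ! (length \<alpha> - 1 - i)) \<noteq> 0)"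

definition ASSR :: "nat \<Rightarrow> (nat \<Rightarrow> real) \<Rightarrow> real mat \<Rightarrow> bool" where
  "ASSR n \<epsilon> A \<longleftrightarrow>
     (\<forall>m\<in>{1..n}. \<epsilon> m \<in> {-1, 1}) \<and>
     (type_I_staircase n A \<and>
        (\<forall>m\<in>{1..n}. \<forall>\<alpha>\<in>Q m n. \<forall>\<beta>\<in>Q m n.
           nontrivial_I A \<alpha> \<beta> \<longrightarrow> \<epsilon> m * det (submat A \<alpha> \<beta>) > 0)
      \<or> type_II_staircase n A \<and>
        (\<forall>m\<in>{1..n}. \<forall>\<alpha>\<in>Q m n. \<forall>\<beta>\<in>Q m n.
           nontrivial_II A \<alpha> \<beta> \<longrightarrow> \<epsilon> m * det (submat A \<alpha> \<beta>) > 0))"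

lemma pick_set_eq_nth:
  assumes "sorted_wrt (<) \<alpha>" and "i < length \<alpha>"
  shows "pick (set \<alpha>) i = \<alpha> ! i"
proof -
  have inj: "inj_on ((!) \<alpha>) {..<i}"
    using assms by (intro inj_on_nth) (auto simp: strict_sorted_iff)
  have "{a \<in> set \<alpha>. a < \<alpha> ! i} = (!) \<alpha> ` {..<i}"
  proof (intro equalityI subsetI)
    fix a assume "a \<in> {a \<in> set \<alpha>. a < \<alpha> ! i}"
    then obtain k where k: "k < length \<alpha>" "a = \<alpha> ! k" "\<alpha> ! k < \<alpha> ! i"
      by (auto simp: in_set_conv_nth)
    have "k < i"
    proof (rule ccontr)
      assume "\<not> k < i"
      then have "\<alpha> ! i \<le> \<alpha> ! k"
        using assms k(1) by (cases "i = k") (auto simp: sorted_wrt_iff_nth_less intro!: less_imp_le)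
      then show False using k(3) by simp
    qed
    then show "a \<in> (!) \<alpha> ` {..<i}" using k(2) by blast
  next
    fix a assume "a \<in> (!) \<alpha> ` {..<i}"
    then show "a \<in> {a \<in> set \<alpha>. a < \<alpha> ! i}"
      using assms by (auto simp: sorted_wrt_iff_nth_less)
  qed
  then have "card {a \<in> set \<alpha>. a < \<alpha> ! i} = i"
    using card_image[OF inj] by simp
  moreover have "pick (set \<alpha>) (card {a \<in> set \<alpha>. a < \<alpha> ! i}) = \<alpha> ! i"
    using assms(2) by (intro pick_card_in_set) simp
  ultimately show ?thesis by simp
qed

lemma submat_eq:
  assumes "A \<in> carrier_mat n n" and "\<alpha> \<in> Q m n" and "\<beta> \<in> Q m n"
  shows "submat A \<alpha> \<beta> = mat m m (\<lambda>(i, j). A $$ (\<alpha> ! i, \<beta> ! j))"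
proof -
  have "card {i. i < n \<and> i \<in> set \<gamma>} = m" if "\<gamma> \<in> Q m n" for \<gamma>
  proof -
    have "{i. i < n \<and> i \<in> set \<gamma>} = set \<gamma>" using that by (auto simp: Q_def)
    moreover have "card (set \<gamma>) = m"
      using that by (auto simp: Q_def strict_sorted_iff distinct_card)
    ultimately show ?thesis by simp
  qed
  then show ?thesis
    using assms unfolding submat_def submatrix_def
    by (intro eq_matI) (auto simp: Q_def pick_set_eq_nth)
qed

end

theory Submission
  imports Defs
begin

text \<open>
  A trivial minor of a type-I staircase matrix vanishes: a zero \<open>a\<^bsub>\<alpha>\<^sub>t\<beta>\<^sub>t\<^esub>\<close> on the diagonal of
  \<open>A[\<alpha>|\<beta>]\<close> spreads to a zero block too large for a nonsingular matrix. In an ASSR matrix the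
  trivial minors are therefore exactly the vanishing ones. Up to sign and the factor \<open>det A\<close>, the
  entry \<open>c\<^bsub>ij\<^esub>\<close> is \<open>a\<^bsub>ij\<^esub>\<close> times the minor that omits row \<open>i\<close> and column \<open>j\<close>. For \<open>i \<ge> j\<close> the
  diagonal of that minor consists of diagonal entries of \<open>A\<close> and of the superdiagonal entries
  \<open>a\<^bsub>t,t+1\<^esub>\<close> with \<open>j \<le> t < i\<close>, so it vanishes iff one of the latter does, a condition that
  persists when \<open>i\<close> grows and \<open>j\<close> shrinks. The upper triangle follows since \<open>C(A\<^sup>T) = C(A)\<^sup>T\<close>.
  A matrix that is staircase of both types has no zero entry, so for it the two notions of
  nontriviality agree.
\<close>

subsection \<open>Determinants, cofactors and inverses\<close>

lemma det_eq_0_if_zero_block: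
  fixes B :: "'a :: comm_ring_1 mat"
  assumes B: "B \<in> carrier_mat m m"
    and I: "I \<subseteq> {0..<m}" and J: "J \<subseteq> {0..<m}" and large: "m < card I + card J"
    and zero: "\<And>i j. i \<in> I \<Longrightarrow> j \<in> J \<Longrightarrow> B $$ (i, j) = 0"
  shows "det B = 0"
proof -
  have "(\<Prod>i = 0..<m. B $$ (i, p i)) = 0" if p: "p permutes {0..<m}" for p
  proof -
    have "p ` I \<inter> J \<noteq> {}"
    proof
      assume disjoint: "p ` I \<inter> J = {}"
      have "p ` I \<subseteq> {0..<m}" using I permutes_image[OF p] by blast
      then have "card (p ` I \<union> J) \<le> m" using J card_mono[of "{0..<m}"] by fastforce
      moreover have "card (p ` I \<union> J) = card (p ` I) + card J"
        using I J disjoint by (intro card_Un_disjoint) (auto intro: finite_subset)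
      moreover have "card (p ` I) = card I" using permutes_inj_on[OF p] by (rule card_image)
      ultimately show False using large by simp
    qed
    then show ?thesis using zero I by (intro prod_zero) auto
  qed
  then show ?thesis by (simp add: det_def'[OF B])
qed

lemma cofactor_transpose_mat:
  fixes A :: "'a :: comm_ring_1 mat"
  assumes A: "A \<in> carrier_mat n n"
  shows "cofactor A\<^sup>T i j = cofactor A j i"
proof -
  have "mat_delete A\<^sup>T i j = (mat_delete A j i)\<^sup>T"
    using A by (intro eq_matI) (auto simp: mat_delete_def)
  then show ?thesis
    by (simp add: cofactor_def det_transpose[OF mat_delete_carrier[OF A]] add.commute)
qed

lemma mat_inverse_eq_adj_mat:
  fixes A :: "'a :: field mat"
  assumes A: "A \<in> carrier_mat n n" and "det A \<noteq> 0"
  shows "mat_inverse A = Some (inverse (det A) \<cdot>\<^sub>m adj_mat A)"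
proof -
  define C where "C = inverse (det A) \<cdot>\<^sub>m adj_mat A"
  have C: "C \<in> carrier_mat n n" using adj_mat(1)[OF A] by (simp add: C_def)
  have "A * C = inverse (det A) \<cdot>\<^sub>m (det A \<cdot>\<^sub>m 1\<^sub>m n)"
    using mult_smult_distrib[OF A adj_mat(1)[OF A]] adj_mat(2)[OF A] by (simp add: C_def)
  also have "\<dots> = 1\<^sub>m n" using \<open>det A \<noteq> 0\<close> by (intro eq_matI) auto
  finally have right_inverse: "A * C = 1\<^sub>m n" .
  obtain B where B: "mat_inverse A = Some B"
    using det_non_zero_imp_unit[OF A \<open>det A \<noteq> 0\<close>, of "()"] mat_inverse(1)[OF A, of "()"]
    by (cases "mat_inverse A") auto
  then have left_inverse: "B * A = 1\<^sub>m n" and B_carrier: "B \<in> carrier_mat n n"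
    using mat_inverse(2)[OF A] by auto
  have "B = B * (A * C)" using right_inverse B_carrier by simp
  also have "\<dots> = C" using left_inverse assoc_mult_mat[OF B_carrier A C] C by simp
  finally show ?thesis using B by (simp add: C_def)
qed

subsection \<open>Index sequences and minors\<close>

lemma Q_nth_less: "\<alpha> \<in> Q m n \<Longrightarrow> i < m \<Longrightarrow> \<alpha> ! i < n"
  using nth_mem[of i \<alpha>] by (auto simp: Q_def subset_iff)

lemma Q_nth_mono: "\<alpha> \<in> Q m n \<Longrightarrow> i \<le> j \<Longrightarrow> j < m \<Longrightarrow> \<alpha> ! i \<le> \<alpha> ! j"
  by (auto simp: Q_def strict_sorted_iff intro: sorted_nth_mono)

lemma Q_imp_le:
  assumes "\<alpha> \<in> Q m n"
  shows "m \<le> n"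
proof -
  have "card (set \<alpha>) = m" and "set \<alpha> \<subseteq> {..<n}"
    using assms by (auto simp: Q_def strict_sorted_iff distinct_card)
  then show ?thesis using card_mono[of "{..<n}" "set \<alpha>"] by simp
qed

lemma upt_in_Q: "[0..<n] \<in> Q n n"
  by (auto simp: Q_def)

lemma submat_upt: "A \<in> carrier_mat n n \<Longrightarrow> submat A [0..<n] [0..<n] = A"
  by (intro eq_matI) (auto simp: submat_eq[OF _ upt_in_Q upt_in_Q])

lemma submat_transpose_mat:
  assumes "A \<in> carrier_mat n n" and \<alpha>: "\<alpha> \<in> Q m n" and \<beta>: "\<beta> \<in> Q m n"
  shows "submat A\<^sup>T \<alpha> \<beta> = (submat A \<beta> \<alpha>)\<^sup>T"
  using assms(1) Q_nth_less[OF \<alpha>] Q_nth_less[OF \<beta>]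
  by (intro eq_matI) (auto simp: submat_eq[OF _ \<alpha> \<beta>] submat_eq[OF _ \<beta> \<alpha>])

lemma nontrivial_I_transpose_mat:
  assumes "A \<in> carrier_mat n n" and \<alpha>: "\<alpha> \<in> Q m n" and \<beta>: "\<beta> \<in> Q m n"
  shows "nontrivial_I A\<^sup>T \<alpha> \<beta> \<longleftrightarrow> nontrivial_I A \<beta> \<alpha>"
proof -
  have "length \<alpha> = m" "length \<beta> = m" using \<alpha> \<beta> by (auto simp: Q_def)
  then show ?thesis
    using assms(1) Q_nth_less[OF \<alpha>] Q_nth_less[OF \<beta>] by (auto simp: nontrivial_I_def)
qed

definition indices_except :: "nat \<Rightarrow> nat \<Rightarrow> nat list" where
  "indices_except n i = map (insert_index i) [0..<n - 1]"

lemma indices_except_in_Q: "indices_except n i \<in> Q (n - 1) n"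
  by (auto simp: indices_except_def Q_def sorted_wrt_iff_nth_less insert_index_def)

lemma mat_delete_eq_submat:
  assumes "A \<in> carrier_mat n n"
  shows "mat_delete A i j = submat A (indices_except n i) (indices_except n j)"
  using assms unfolding submat_eq[OF assms indices_except_in_Q indices_except_in_Q]
  by (intro eq_matI) (auto simp: mat_delete_def indices_except_def insert_index_def)

subsection \<open>Staircase matrices\<close>

definition lower_staircase :: "nat \<Rightarrow> 'a :: zero mat \<Rightarrow> bool" where
  "lower_staircase n A \<longleftrightarrow>
     (\<forall>i<n. \<forall>j<n. i > j \<and> A $$ (i, j) = 0 \<longrightarrow>
        (\<forall>k<n. \<forall>l<n. l \<le> j \<and> k \<ge> i \<longrightarrow> A $$ (k, l) = 0))"

lemma lower_staircaseD:
  assumes "lower_staircase n A" "A $$ (i, j) = 0" "j < i" "i \<le> k" "k < n" "l \<le> j"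
  shows "A $$ (k, l) = 0"
proof -
  have "i < n" "j < n" "l < n" using assms by auto
  then show ?thesis using assms unfolding lower_staircase_def by blast
qed

lemma lower_staircase_transpose_mat_iff:
  assumes "A \<in> carrier_mat n n"
  shows "lower_staircase n A\<^sup>T \<longleftrightarrow>
    (\<forall>i<n. \<forall>j<n. i < j \<and> A $$ (i, j) = 0 \<longrightarrow>
       (\<forall>k<n. \<forall>l<n. k \<le> i \<and> l \<ge> j \<longrightarrow> A $$ (k, l) = 0))"
proof -
  have "lower_staircase n A\<^sup>T \<longleftrightarrow>
    (\<forall>j<n. \<forall>i<n. i < j \<and> A $$ (i, j) = 0 \<longrightarrow>
       (\<forall>l<n. \<forall>k<n. k \<le> i \<and> l \<ge> j \<longrightarrow> A $$ (k, l) = 0))"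
    using assms by (simp add: lower_staircase_def)
  then show ?thesis by auto
qed

lemma type_I_staircase_iff_lower_staircase:
  "type_I_staircase n A \<longleftrightarrow>
     A \<in> carrier_mat n n \<and> (\<forall>i<n. A $$ (i, i) \<noteq> 0) \<and> lower_staircase n A \<and> lower_staircase n A\<^sup>T"
  by (cases "A \<in> carrier_mat n n")
    (simp_all add: type_I_staircase_def lower_staircase_transpose_mat_iff
      lower_staircase_def[of n A])

lemma type_I_staircase_carrier: "type_I_staircase n A \<Longrightarrow> A \<in> carrier_mat n n"
  and type_I_staircase_diag: "type_I_staircase n A \<Longrightarrow> i < n \<Longrightarrow> A $$ (i, i) \<noteq> 0"
  and type_I_staircase_imp_lower_staircase: "type_I_staircase n A \<Longrightarrow> lower_staircase n A"
  by (simp_all add: type_I_staircase_iff_lower_staircase)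

lemma type_I_staircase_transpose_mat:
  "type_I_staircase n A \<Longrightarrow> type_I_staircase n A\<^sup>T"
  by (auto simp: type_I_staircase_iff_lower_staircase)

lemmas type_I_staircase_lower = type_I_staircase_imp_lower_staircase[THEN lower_staircaseD]

lemma type_I_staircase_upper:
  assumes staircase: "type_I_staircase n A" and "A $$ (i, j) = 0" "i < j" "k \<le> i" "j \<le> l" "l < n"
  shows "A $$ (k, l) = 0"
  using type_I_staircase_lower[OF type_I_staircase_transpose_mat[OF staircase], of j i l k]
    type_I_staircase_carrier[OF staircase] assms by simp

lemma type_I_II_staircase_nonzero:
  assumes I: "type_I_staircase n A" and II: "type_II_staircase n A" and "i < n" "j < n"
  shows "A $$ (i, j) \<noteq> 0"
proof
  assume zero: "A $$ (i, j) = 0"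
  have antidiag: "A $$ (k, n - 1 - k) \<noteq> 0" if "k < n" for k
    using II that unfolding type_II_staircase_def by iprover
  show False
  proof (cases i j rule: linorder_cases)
    case less
    then show ?thesis
      using type_I_staircase_upper[OF I zero, of 0 "n - 1"] antidiag[of 0] assms by simp
  next
    case equal
    then show ?thesis using zero type_I_staircase_diag[OF I] assms by simp
  next
    case greater
    then show ?thesis
      using type_I_staircase_lower[OF I zero, of "n - 1" 0] antidiag[of "n - 1"] assms by simp
  qed
qed

lemma det_submat_eq_0_if_trivial:
  assumes staircase: "type_I_staircase n A" and \<alpha>: "\<alpha> \<in> Q m n" and \<beta>: "\<beta> \<in> Q m n"
    and trivial: "\<not> nontrivial_I A \<alpha> \<beta>"
  shows "det (submat A \<alpha> \<beta>) = 0"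
proof -
  note submat = submat_eq[OF type_I_staircase_carrier[OF staircase] \<alpha> \<beta>]
  obtain t where "t < m" and zero: "A $$ (\<alpha> ! t, \<beta> ! t) = 0"
    using trivial \<alpha> by (auto simp: nontrivial_I_def Q_def)
  have "\<alpha> ! t \<noteq> \<beta> ! t"
    using zero type_I_staircase_diag[OF staircase Q_nth_less[OF \<alpha> \<open>t < m\<close>]] by metis
  then consider (upper) "\<alpha> ! t < \<beta> ! t" | (lower) "\<beta> ! t < \<alpha> ! t" by linarith
  then show ?thesis
  proof cases
    case upper
    have "submat A \<alpha> \<beta> $$ (i, j) = 0" if "i \<in> {0..t}" "j \<in> {t..<m}" for i j
      using type_I_staircase_upper[OF staircase zero upper Q_nth_mono[OF \<alpha>]
          Q_nth_mono[OF \<beta>] Q_nth_less[OF \<beta>]]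
        that \<open>t < m\<close> by (simp add: submat)
    then show ?thesis
      using \<open>t < m\<close> by (intro det_eq_0_if_zero_block[of _ m "{0..t}" "{t..<m}"])
          (auto simp: submat)
  next
    case lower
    have "submat A \<alpha> \<beta> $$ (i, j) = 0" if "i \<in> {t..<m}" "j \<in> {0..t}" for i j
      using type_I_staircase_lower[OF staircase zero lower Q_nth_mono[OF \<alpha>]
          Q_nth_less[OF \<alpha>] Q_nth_mono[OF \<beta>]]
        that \<open>t < m\<close> by (simp add: submat)
    then show ?thesis
      using \<open>t < m\<close> by (intro det_eq_0_if_zero_block[of _ m "{t..<m}" "{0..t}"])
          (auto simp: submat)
  qed
qed

lemma nontrivial_I_indices_except_iff:
  assumes staircase: "type_I_staircase n A" and "j \<le> i" "i < n"
  shows "nontrivial_I A (indices_except n i) (indices_except n j) \<longleftrightarrow>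
    (\<forall>t\<in>{j..<i}. A $$ (t, Suc t) \<noteq> 0)"
proof -
  have "A $$ (insert_index i t, insert_index j t) \<noteq> 0 \<longleftrightarrow>
      (t \<in> {j..<i} \<longrightarrow> A $$ (t, Suc t) \<noteq> 0)" if "t < n - 1" for t
    using that \<open>j \<le> i\<close> type_I_staircase_diag[OF staircase, of t]
      type_I_staircase_diag[OF staircase, of "Suc t"]
    by (auto simp: insert_index_def)
  then show ?thesis using \<open>i < n\<close> by (auto simp: nontrivial_I_def indices_except_def)
qed

subsection \<open>Matrices whose nontrivial minors do not vanish\<close>

definition nontrivial_minors_nonzero :: "nat \<Rightarrow> real mat \<Rightarrow> bool" where
  "nontrivial_minors_nonzero n A \<longleftrightarrow>
     (\<forall>m. \<forall>\<alpha>\<in>Q m n. \<forall>\<beta>\<in>Q m n. nontrivial_I A \<alpha> \<beta> \<longrightarrow> det (submat A \<alpha> \<beta>) \<noteq> 0)"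

lemma nontrivial_minors_nonzeroD:
  "\<lbrakk>nontrivial_minors_nonzero n A; \<alpha> \<in> Q m n; \<beta> \<in> Q m n; nontrivial_I A \<alpha> \<beta>\<rbrakk>
    \<Longrightarrow> det (submat A \<alpha> \<beta>) \<noteq> 0"
  unfolding nontrivial_minors_nonzero_def by blast

lemma nontrivial_minors_nonzero_transpose_mat:
  assumes A: "A \<in> carrier_mat n n" and minors: "nontrivial_minors_nonzero n A"
  shows "nontrivial_minors_nonzero n A\<^sup>T"
  unfolding nontrivial_minors_nonzero_def
proof (intro allI ballI impI)
  fix m \<alpha> \<beta>
  assume \<alpha>: "\<alpha> \<in> Q m n" and \<beta>: "\<beta> \<in> Q m n" and "nontrivial_I A\<^sup>T \<alpha> \<beta>"
  then have "det (submat A \<beta> \<alpha>) \<noteq> 0"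
    using nontrivial_minors_nonzeroD[OF minors \<beta> \<alpha>] nontrivial_I_transpose_mat[OF A \<alpha> \<beta>] by simp
  moreover have "submat A \<beta> \<alpha> \<in> carrier_mat m m" by (simp add: submat_eq[OF A \<beta> \<alpha>])
  ultimately show "det (submat A\<^sup>T \<alpha> \<beta>) \<noteq> 0"
    by (simp add: submat_transpose_mat[OF A \<alpha> \<beta>] det_transpose)
qed

lemma ASSR_imp_nontrivial_minors_nonzero:
  assumes ASSR: "ASSR n \<epsilon> A" and I: "type_I_staircase n A"
  shows "nontrivial_minors_nonzero n A"
  unfolding nontrivial_minors_nonzero_def
proof (intro allI ballI impI)
  fix m \<alpha> \<beta>
  assume \<alpha>: "\<alpha> \<in> Q m n" and \<beta>: "\<beta> \<in> Q m n" and nontrivial: "nontrivial_I A \<alpha> \<beta>"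
  show "det (submat A \<alpha> \<beta>) \<noteq> 0"
  proof (cases "m = 0")
    case True
    then show ?thesis by (simp add: submat_eq[OF type_I_staircase_carrier[OF I] \<alpha> \<beta>])
  next
    case False
    then have "m \<in> {1..n}" using Q_imp_le[OF \<alpha>] by simp
    moreover have "nontrivial_II A \<alpha> \<beta>" if "type_II_staircase n A"
      using type_I_II_staircase_nonzero[OF I that] Q_nth_less[OF \<alpha>] Q_nth_less[OF \<beta>] \<alpha>
      by (simp add: nontrivial_II_def Q_def)
    ultimately have "\<epsilon> m * det (submat A \<alpha> \<beta>) > 0"
      using ASSR \<alpha> \<beta> nontrivial unfolding ASSR_def by metis
    then show ?thesis by auto
  qed
qed

lemma det_nonzero_if_nontrivial_minors_nonzero:
  assumes staircase: "type_I_staircase n A" and minors: "nontrivial_minors_nonzero n A"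
  shows "det A \<noteq> 0"
proof -
  have "nontrivial_I A [0..<n] [0..<n]"
    using type_I_staircase_diag[OF staircase] by (simp add: nontrivial_I_def)
  then have "det (submat A [0..<n] [0..<n]) \<noteq> 0"
    by (rule nontrivial_minors_nonzeroD[OF minors upt_in_Q upt_in_Q])
  then show ?thesis by (simp add: submat_upt[OF type_I_staircase_carrier[OF staircase]])
qed

lemma cofactor_eq_0_iff_superdiag:
  assumes staircase: "type_I_staircase n A" and minors: "nontrivial_minors_nonzero n A"
    and "j \<le> i" "i < n"
  shows "cofactor A i j = 0 \<longleftrightarrow> (\<exists>t\<in>{j..<i}. A $$ (t, Suc t) = 0)"
proof -
  let ?\<alpha> = "indices_except n i" and ?\<beta> = "indices_except n j"
  have "cofactor A i j = 0 \<longleftrightarrow> det (submat A ?\<alpha> ?\<beta>) = 0"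
    by (simp add: cofactor_def mat_delete_eq_submat[OF type_I_staircase_carrier[OF staircase]])
  also have "\<dots> \<longleftrightarrow> \<not> nontrivial_I A ?\<alpha> ?\<beta>"
    using det_submat_eq_0_if_trivial[OF staircase indices_except_in_Q indices_except_in_Q]
      nontrivial_minors_nonzeroD[OF minors indices_except_in_Q indices_except_in_Q] by blast
  finally show ?thesis using nontrivial_I_indices_except_iff[OF assms(1,3,4)] by blast
qed

subsection \<open>The combined matrix\<close>

lemma combined_matrix_eq_cofactor:
  assumes A: "A \<in> carrier_mat n n" and "det A \<noteq> 0"
  shows "combined_matrix A = mat n n (\<lambda>(i, j). A $$ (i, j) * cofactor A i j / det A)"
  using assms adj_mat(1)[OF A]
  by (intro eq_matI)
    (auto simp: combined_matrix_def hadamard_prod_def mat_inverse_eq_adj_mat[OF assms]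
      adj_mat_def divide_inverse)

lemma combined_matrix_transpose_mat:
  assumes A: "A \<in> carrier_mat n n" and "det A \<noteq> 0"
  shows "combined_matrix A\<^sup>T = (combined_matrix A)\<^sup>T"
proof -
  have "A\<^sup>T \<in> carrier_mat n n" and "det A\<^sup>T = det A" using A by (auto simp: det_transpose)
  then show ?thesis
    using assms by (intro eq_matI) (auto simp: combined_matrix_eq_cofactor cofactor_transpose_mat)
qed

lemma lower_staircase_combined_matrix:
  assumes staircase: "type_I_staircase n A" and minors: "nontrivial_minors_nonzero n A"
  shows "lower_staircase n (combined_matrix A)"
proof -
  note det = det_nonzero_if_nontrivial_minors_nonzero[OF staircase minors]
  have combined_eq_0_iff: "combined_matrix A $$ (i, j) = 0 \<longleftrightarrow>
      A $$ (i, j) = 0 \<or> (\<exists>t\<in>{j..<i}. A $$ (t, Suc t) = 0)" if "j \<le> i" "i < n" for i j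
    using combined_matrix_eq_cofactor[OF type_I_staircase_carrier[OF staircase] det] det that
      cofactor_eq_0_iff_superdiag[OF staircase minors that] by simp
  show ?thesis
    unfolding lower_staircase_def
  proof (intro allI impI, elim conjE)
    fix i j k l
    assume "i < n" "j < i" "combined_matrix A $$ (i, j) = 0" and "k < n" "l \<le> j" "i \<le> k"
    then consider (entry) "A $$ (i, j) = 0"
      | (superdiag) t where "t \<in> {j..<i}" "A $$ (t, Suc t) = 0"
      using combined_eq_0_iff[of j i] by auto
    then have "A $$ (k, l) = 0 \<or> (\<exists>t\<in>{l..<k}. A $$ (t, Suc t) = 0)"
    proof cases
      case entry
      then show ?thesis
        using type_I_staircase_lower[OF staircase _ \<open>j < i\<close> \<open>i \<le> k\<close> \<open>k < n\<close> \<open>l \<le> j\<close>] by blast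
    next
      case (superdiag t)
      then have "t \<in> {l..<k}" using \<open>l \<le> j\<close> \<open>i \<le> k\<close> by auto
      then show ?thesis using superdiag by blast
    qed
    then show "combined_matrix A $$ (k, l) = 0"
      using combined_eq_0_iff[of l k] \<open>l \<le> j\<close> \<open>j < i\<close> \<open>i \<le> k\<close> \<open>k < n\<close> by auto
  qed
qed

lemma type_I_staircase_combined_matrix:
  assumes staircase: "type_I_staircase n A" and minors: "nontrivial_minors_nonzero n A"
  shows "type_I_staircase n (combined_matrix A)"
  unfolding type_I_staircase_iff_lower_staircase
proof (intro conjI allI impI)
  note A = type_I_staircase_carrier[OF staircase]
  have det: "det A \<noteq> 0" using staircase minors by (rule det_nonzero_if_nontrivial_minors_nonzero)
  note combined = combined_matrix_eq_cofactor[OF A det]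
  show "combined_matrix A \<in> carrier_mat n n" by (simp add: combined)
  show "combined_matrix A $$ (i, i) \<noteq> 0" if "i < n" for i
    using that det type_I_staircase_diag[OF staircase]
      cofactor_eq_0_iff_superdiag[OF staircase minors, of i i]
    by (simp add: combined)
  show "lower_staircase n (combined_matrix A)"
    using staircase minors by (rule lower_staircase_combined_matrix)
  show "lower_staircase n (combined_matrix A)\<^sup>T"
    using lower_staircase_combined_matrix[OF type_I_staircase_transpose_mat[OF staircase]
        nontrivial_minors_nonzero_transpose_mat[OF A minors]]
    by (simp add: combined_matrix_transpose_mat[OF A det])
qed

theorem theorem3:
  fixes n :: nat and A :: "real mat" and \<epsilon> :: "nat \<Rightarrow> real"
  assumes "ASSR n \<epsilon> A"
    and "type_I_staircase n A"
  shows "type_I_staircase n (combined_matrix A)"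
proof -
  have "nontrivial_minors_nonzero n A"
    using assms by (rule ASSR_imp_nontrivial_minors_nonzero)
  then show ?thesis
    using assms(2) by (intro type_I_staircase_combined_matrix)
qed

end
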